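(* Let $C^0,\dots,C^d$ and $\delta_k: C^k\to C^{k+1}$ ($0\le k\le d-1$) be the graph cochain spaces and coboundary operators of a finite clique complex, let $\mathbf{B}_k$ ($0\le k\le d$) be diagonal matrices with positive diagonal entries acting on $C^k$, and set $\mathsf{d}_k := \mathbf{B}_{k+1}\,\delta_k\,\mathbf{B}_k^{-1}: C^k\to C^{k+1}$. If the sequence $$C^0\xrightarrow{\ \delta_0\ }C^1\xrightarrow{\ \delta_1\ }\cdots\xrightarrow{\ \delta_{d-1}\ }C^d$$ is exact, i.e. $\ker(\delta_k)=\operatorname{im}(\delta_{k-1})$ for all $1\le k\le d-1$, then the sequence $$C^0\xrightarrow{\ \mathsf{d}_0\ }C^1\xrightarrow{\ \mathsf{d}_1\ }\cdots\xrightarrow{\ \mathsf{d}_{d-1}\ }C^d$$ is exact, i.e. $\ker(\mathsf{d}_k)=\operatorname{im}(\mathsf{d}_{k-1})$ for all $1\le k\le d-1$. Moreover $\mathsf{d}_{k+1}\circ\mathsf{d}_k=0$ for all $0\le k\le d-2$.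
   Context: Fix $d\ge 1$, a finite node set, and a finite family of cliques (nonempty sets of at most $d+1$ nodes) that is closed under taking nonempty subsets (a simplicial complex). $C^k$ is the finite-dimensional real vector space of $k$-cochains: alternating real-valued functions $\phi$ on ordered $(k+1)$-cliques, $\phi_{i_{\pi(0)}\cdots i_{\pi(k)}}=\operatorname{sgn}(\pi)\,\phi_{i_0\cdots i_k}$. Fixing one orientation for each $(k+1)$-clique identifies $C^k$ with $\mathbb{R}^{N_k}$, where $N_k$ is the number of $(k+1)$-cliques; diagonal matrices act in these coordinates. The coboundary is $$(\delta_k\phi)_{i_0\cdots i_{k+1}}=\sum_{j=0}^{k+1}(-1)^j\phi_{i_0\cdots\widehat{i_j}\cdots i_{k+1}},$$ (so $(\delta_0\phi)_{ij}=\phi_j-\phi_i$ and $(\delta_1\phi)_{ijk}=\phi_{ij}+\phi_{jk}+\phi_{ki}$), and satisfies $\delta_{k+1}\circ\delta_k=0$. *)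

theory Defs
  imports
    "HOL-Combinatorics.Permutations"
    "Jordan_Normal_Form.Matrix"
begin

definition clique_complex :: "nat \<Rightarrow> 'v set \<Rightarrow> 'v set set \<Rightarrow> bool" where
  "clique_complex d V K \<longleftrightarrow>
     finite V \<and>
     (\<forall>\<sigma>\<in>K. \<sigma> \<subseteq> V \<and> \<sigma> \<noteq> {} \<and> card \<sigma> \<le> d + 1) \<and>
     (\<forall>\<sigma>\<in>K. \<forall>\<tau>. \<tau> \<subseteq> \<sigma> \<and> \<tau> \<noteq> {} \<longrightarrow> \<tau> \<in> K)"

text \<open>The index \<open>k\<close> is the dimension throughout: \<open>cliques K k\<close> are the cliques with
  \<open>k + 1\<close> nodes, and \<open>ordered_cliques K k\<close> are their orderings \<open>[i_0, ..., i_k]\<close>.\<close>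

definition cliques :: "'v set set \<Rightarrow> nat \<Rightarrow> 'v set set" where
  "cliques K k = {\<sigma> \<in> K. card \<sigma> = k + 1}"

definition ordered_cliques :: "'v set set \<Rightarrow> nat \<Rightarrow> 'v list set" where
  "ordered_cliques K k = {xs. distinct xs \<and> length xs = k + 1 \<and> set xs \<in> K}"

text \<open>A cochain is a function on ordered cliques only; it is represented by its extension by
  zero to all lists, so that equality of cochains is equality of functions.\<close>

definition cochains :: "'v set set \<Rightarrow> nat \<Rightarrow> ('v list \<Rightarrow> real) set" where
  "cochains K k = {\<phi>.
     (\<forall>xs. xs \<notin> ordered_cliques K k \<longrightarrow> \<phi> xs = 0) \<and>
     (\<forall>xs \<in> ordered_cliques K k. \<forall>\<pi>. \<pi> permutes {..<k + 1} \<longrightarrow>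
        \<phi> (permute_list \<pi> xs) = of_int (sign \<pi>) * \<phi> xs)}"

definition coboundary :: "'v set set \<Rightarrow> nat \<Rightarrow> ('v list \<Rightarrow> real) \<Rightarrow> 'v list \<Rightarrow> real" where
  "coboundary K k \<phi> xs =
     (if xs \<in> ordered_cliques K (k + 1)
      then \<Sum>j\<le>k + 1. (- 1) ^ j * \<phi> (take j xs @ drop (Suc j) xs) else 0)"

text \<open>An enumeration \<open>os\<close> of the cliques in \<open>cliques K k\<close>, each listed once and with one
  chosen orientation.\<close>

definition orientation :: "'v set set \<Rightarrow> nat \<Rightarrow> 'v list list \<Rightarrow> bool" where
  "orientation K k os \<longleftrightarrow>
     distinct os \<and> set os \<subseteq> ordered_cliques K k \<and> bij_betw set (set os) (cliques K k)"

definition coords :: "'v list list \<Rightarrow> ('v list \<Rightarrow> real) \<Rightarrow> real vec" where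
  "coords os \<phi> = vec (length os) (\<lambda>i. \<phi> (os ! i))"

text \<open>The next lemmas show that \<open>coords os\<close> identifies the space of cochains with
  \<open>\<real>\<^sup>N\<close>, where \<open>N\<close> is the number of cliques, so that the
  inverse used in the definition of \<open>mat_action\<close> is meaningful.\<close>

lemma length_orientation:
  assumes "orientation K k os"
  shows "length os = card (cliques K k)"
  using assms unfolding orientation_def
  by (metis bij_betw_same_card distinct_card)

lemma distinct_set_eq_permute:
  assumes "distinct xs" "distinct ys" "set xs = set ys"
  obtains \<pi> where "\<pi> permutes {..<length xs}" "permute_list \<pi> xs = ys"
  using assms set_eq_iff_mset_eq_distinct mset_eq_permutation by (metis)

lemma permute_list_distinct_inj:
  assumes "distinct xs" "\<pi> permutes {..<length xs}" "\<rho> permutes {..<length xs}"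
    and "permute_list \<pi> xs = permute_list \<rho> xs"
  shows "\<pi> = \<rho>"
proof
  fix i
  show "\<pi> i = \<rho> i"
  proof (cases "i < length xs")
    case True
    hence "xs ! \<pi> i = xs ! \<rho> i"
      using assms permute_list_nth by metis
    moreover have "\<pi> i < length xs" "\<rho> i < length xs"
      using True assms(2,3) by (metis lessThan_iff permutes_in_image)+
    ultimately show ?thesis
      using assms(1) by (simp add: nth_eq_iff_index_eq)
  next
    case False
    thus ?thesis using assms(2,3) by (metis lessThan_iff permutes_not_in)
  qed
qed

lemma ordered_clique_orientation:
  assumes "orientation K k os" "xs \<in> ordered_cliques K k"
  obtains i \<pi> where "i < length os" "\<pi> permutes {..<k + 1}" "xs = permute_list \<pi> (os ! i)"
proof -
  have "set xs \<in> cliques K k"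
    using assms(2) by (auto simp: ordered_cliques_def cliques_def distinct_card)
  then obtain i where i: "i < length os" "set (os ! i) = set xs"
    using assms(1) unfolding orientation_def bij_betw_def
    by (metis (no_types, lifting) imageE in_set_conv_nth)
  have "os ! i \<in> ordered_cliques K k"
    using assms(1) i unfolding orientation_def by auto
  then obtain \<pi> where "\<pi> permutes {..<k + 1}" "permute_list \<pi> (os ! i) = xs"
    using distinct_set_eq_permute[of "os ! i" xs] i assms(2) unfolding ordered_cliques_def
    by auto
  with i that show ?thesis by blast
qed

lemma bij_betw_coords:
  assumes os: "orientation K k os"
  shows "bij_betw (coords os) (cochains K k) (carrier_vec (card (cliques K k)))"
  unfolding bij_betw_def
proof (intro conjI)
  have nth_os: "os ! i \<in> ordered_cliques K k" if "i < length os" for i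
    using os that unfolding orientation_def by auto
  show "inj_on (coords os) (cochains K k)"
  proof (rule inj_onI, rule ext)
    fix \<phi> \<psi> xs
    assume C: "\<phi> \<in> cochains K k" "\<psi> \<in> cochains K k" and eq: "coords os \<phi> = coords os \<psi>"
    show "\<phi> xs = \<psi> xs"
    proof (cases "xs \<in> ordered_cliques K k")
      case True
      then obtain i \<pi> where i: "i < length os" "\<pi> permutes {..<k + 1}"
        "xs = permute_list \<pi> (os ! i)"
        using ordered_clique_orientation[OF os] by blast
      have "\<phi> (os ! i) = \<psi> (os ! i)"
        using arg_cong[OF eq, of "\<lambda>v. v $ i"] i by (simp add: coords_def)
      thus ?thesis using C i nth_os[OF i(1)] unfolding cochains_def by auto
    qed (use C in \<open>auto simp: cochains_def\<close>)
  qed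
  have "v \<in> coords os ` cochains K k" if v: "v \<in> carrier_vec (card (cliques K k))" for v
  proof -
    define rep where "rep xs p \<longleftrightarrow> fst p < length os \<and> snd p permutes {..<k + 1} \<and>
      xs = permute_list (snd p) (os ! fst p)" for xs and p :: "nat \<times> (nat \<Rightarrow> nat)"
    have rep_unique: "p = q" if "rep xs p" "rep xs q" for xs p q
    proof -
      have len: "length (os ! fst p) = k + 1" "distinct (os ! fst p)"
        "length (os ! fst q) = k + 1"
        using that nth_os unfolding rep_def ordered_cliques_def by auto
      have "set (os ! fst p) = set (os ! fst q)"
        using that len unfolding rep_def by (metis set_permute_list)
      hence "fst p = fst q"
        using os that unfolding orientation_def bij_betw_def rep_def
        by (metis inj_onD nth_eq_iff_index_eq nth_mem)
      moreover from this have "snd p = snd q"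
        using that len permute_list_distinct_inj[of "os ! fst p"] unfolding rep_def by metis
      ultimately show ?thesis by (simp add: prod_eq_iff)
    qed
    define \<phi> where "\<phi> xs = (if xs \<in> ordered_cliques K k
      then let p = THE p. rep xs p in of_int (sign (snd p)) * v $ fst p else 0)" for xs
    have \<phi>: "\<phi> xs = of_int (sign \<pi>) * v $ i" if "rep xs (i, \<pi>)" for xs i \<pi>
    proof -
      have "(THE p. rep xs p) = (i, \<pi>)" using that rep_unique by blast
      moreover have "xs \<in> ordered_cliques K k"
        using that nth_os[of i] unfolding rep_def ordered_cliques_def by auto
      ultimately show ?thesis unfolding \<phi>_def by simp
    qed
    have "\<phi> (permute_list \<rho> xs) = of_int (sign \<rho>) * \<phi> xs"
      if xs: "xs \<in> ordered_cliques K k" and \<rho>: "\<rho> permutes {..<k + 1}" for xs \<rho>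
    proof -
      obtain i \<pi> where i: "i < length os" "\<pi> permutes {..<k + 1}" "xs = permute_list \<pi> (os ! i)"
        using ordered_clique_orientation[OF os xs] by blast
      have len: "length (os ! i) = k + 1" using nth_os[OF i(1)] by (simp add: ordered_cliques_def)
      have "rep xs (i, \<pi>)" using i by (simp add: rep_def)
      moreover have "rep (permute_list \<rho> xs) (i, \<pi> \<circ> \<rho>)"
        unfolding rep_def using i \<rho> len permutes_compose[OF \<rho> i(2)]
        by (simp add: permute_list_compose)
      moreover have "sign (\<pi> \<circ> \<rho>) = sign \<pi> * sign \<rho>"
        using i(2) \<rho> by (meson finite_lessThan permutation_permutes sign_compose)
      ultimately show ?thesis using \<phi> by simp
    qed
    hence "\<phi> \<in> cochains K k" unfolding cochains_def by (auto simp: \<phi>_def)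
    moreover have "coords os \<phi> = v"
    proof (rule eq_vecI)
      fix i assume "i < dim_vec v"
      hence i: "i < length os" using v length_orientation[OF os] by simp
      hence "rep (os ! i) (i, id)" by (auto simp: rep_def permutes_id)
      thus "coords os \<phi> $ i = v $ i" using \<phi> i by (simp add: coords_def)
    qed (use v length_orientation[OF os] in \<open>simp add: coords_def\<close>)
    ultimately show ?thesis by blast
  qed
  thus "coords os ` cochains K k = carrier_vec (card (cliques K k))"
    using length_orientation[OF os] by (auto simp: coords_def)
qed

definition mat_action ::
    "'v set set \<Rightarrow> nat \<Rightarrow> 'v list list \<Rightarrow> real mat \<Rightarrow> ('v list \<Rightarrow> real) \<Rightarrow> 'v list \<Rightarrow> real" where
  "mat_action K k os M \<phi> = the_inv_into (cochains K k) (coords os) (M *\<^sub>v coords os \<phi>)"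

definition weighted_coboundary ::
    "'v set set \<Rightarrow> (nat \<Rightarrow> 'v list list) \<Rightarrow> (nat \<Rightarrow> real mat) \<Rightarrow> nat \<Rightarrow>
     ('v list \<Rightarrow> real) \<Rightarrow> 'v list \<Rightarrow> real" where
  "weighted_coboundary K os B k \<phi> =
     mat_action K (k + 1) (os (k + 1)) (B (k + 1))
       (coboundary K k
         (the_inv_into (cochains K k) (mat_action K k (os k) (B k)) \<phi>))"

definition exact_sequence ::
    "nat \<Rightarrow> (nat \<Rightarrow> ('v list \<Rightarrow> real) set) \<Rightarrow>
     (nat \<Rightarrow> ('v list \<Rightarrow> real) \<Rightarrow> 'v list \<Rightarrow> real) \<Rightarrow> bool" where
  "exact_sequence d C D \<longleftrightarrow>
     (\<forall>k. 1 \<le> k \<and> k \<le> d - 1 \<longrightarrow> {\<phi> \<in> C k. D k \<phi> = (\<lambda>_. 0)} = D (k - 1) ` C (k - 1))"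

end

theory Submission
  imports Defs
begin

text \<open>
  The weighted sequence is the original one read in rescaled coordinates. A diagonal matrix
  with positive diagonal maps \<open>\<real>\<^sup>N\<close> bijectively onto itself, hence acts as a bijection
  \<open>A\<^sub>k\<close> of the \<open>k\<close>-cochains that fixes \<open>0\<close>. The weighted operator is the
  conjugate \<open>A\<^sub>k\<^sub>+\<^sub>1 \<circ> \<delta>\<^sub>k \<circ> A\<^sub>k\<^sup>-\<^sup>1\<close>, so
  its kernel is the image under \<open>A\<^sub>k\<close> of \<open>ker \<delta>\<^sub>k\<close>, its image is
  the image under \<open>A\<^sub>k\<^sub>+\<^sub>1\<close> of \<open>im \<delta>\<^sub>k\<close>, and in the composite of two
  consecutive weighted operators the factors \<open>A\<^sub>k\<^sub>+\<^sub>1\<close> and its inverse cancel.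
  Exactness and the complex property are therefore transported from \<open>\<delta>\<close>
  (\<open>exact_sequence_conjugate\<close>, \<open>conjugate_compose_zero\<close>).

  The cancellations take place inside the spaces of cochains, so \<open>\<delta>\<^sub>k\<close> has to map
  alternating functions to alternating functions (\<open>coboundary_in_cochains\<close>). Adjacent
  transpositions generate the symmetric group, which reduces this to the effect of exchanging
  two neighbouring nodes. The identity \<open>\<delta>\<^sub>k\<^sub>+\<^sub>1 \<circ> \<delta>\<^sub>k = 0\<close>
  (\<open>coboundary_coboundary\<close>) is the usual pairwise cancellation of the two orders in
  which two nodes can be deleted.
\<close>

section \<open>Alternating functions and adjacent transpositions\<close>

text \<open>Conjugation by the transposition of \<open>a\<close> and \<open>a + 1\<close> shortens the distance
  between the two points of a transposition, so all transpositions, and with them all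
  permutations, are products of adjacent ones.\<close>

lemma permutes_lessThan_adjacent_induct [consumes 1, case_names id adjacent comp]:
  fixes n :: nat
  assumes \<pi>: "\<pi> permutes {..<n}"
    and id: "P id"
    and adj: "\<And>i. Suc i < n \<Longrightarrow> P (transpose i (Suc i))"
    and comp: "\<And>p q. p permutes {..<n} \<Longrightarrow> q permutes {..<n} \<Longrightarrow> P p \<Longrightarrow> P q \<Longrightarrow> P (p \<circ> q)"
  shows "P \<pi>"
proof -
  have less: "P (transpose a (a + Suc m))" if "a + Suc m < n" for a m
    using that
  proof (induction m arbitrary: a)
    case 0
    then show ?case using adj[of a] by simp
  next
    case (Suc m)
    let ?s = "transpose a (Suc a)" and ?t = "transpose (Suc a) (Suc a + Suc m)"
    have s: "?s permutes {..<n}" and t: "?t permutes {..<n}"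
      using Suc.prems by (auto intro!: permutes_swap_id)
    have "P ?s" using adj[of a] Suc.prems by simp
    moreover have "P ?t" using Suc.IH[of "Suc a"] Suc.prems by simp
    ultimately have "P (?s \<circ> ?t \<circ> ?s)"
      by (intro comp permutes_compose s t)
    moreover have "?s \<circ> ?t \<circ> ?s = transpose a (a + Suc (Suc m))"
      by (auto simp: fun_eq_iff transpose_def)
    ultimately show ?case by simp
  qed
  have transp: "P (transpose a b)" if "a < n" "b < n" "a \<noteq> b" for a b
  proof (cases "a < b")
    case True
    then show ?thesis using less[of a "b - a - 1"] that by simp
  next
    case False
    then show ?thesis using less[of b "a - b - 1"] that by (simp add: transpose_commute)
  qed
  show ?thesis
    using \<pi> finite_lessThan
  proof (induction rule: permutes_induct)
    case (swap a b p)
    then show ?case by (intro comp transp permutes_swap_id) auto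
  qed (rule id)
qed

lemma permute_list_adjacent:
  "permute_list (transpose (length us) (Suc (length us))) (us @ a # b # vs) = us @ b # a # vs"
  (is "permute_list ?t ?xs = _")
proof (rule nth_equalityI)
  fix i assume "i < length (permute_list ?t ?xs)"
  moreover have "?t permutes {..<length ?xs}"
    by (rule permutes_swap_id) auto
  ultimately show "permute_list ?t ?xs ! i = (us @ b # a # vs) ! i"
    by (auto simp: permute_list_nth transpose_def nth_append nth_Cons' )
qed simp

lemma permute_list_ordered_clique:
  assumes "xs \<in> ordered_cliques K k" "\<pi> permutes {..<k + 1}"
  shows "permute_list \<pi> xs \<in> ordered_cliques K k"
  using assms by (auto simp: ordered_cliques_def)

text \<open>The permutations \<open>\<pi>\<close> that transform \<open>\<phi>\<close> by \<open>sign \<pi>\<close> on every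
  ordered clique are closed under composition, so it suffices to test adjacent
  transpositions.\<close>

lemma cochainsI_adjacent:
  assumes supp: "\<And>xs. xs \<notin> ordered_cliques K k \<Longrightarrow> \<phi> xs = 0"
    and swap: "\<And>us a b vs. us @ a # b # vs \<in> ordered_cliques K k \<Longrightarrow>
      \<phi> (us @ b # a # vs) = - \<phi> (us @ a # b # vs)"
  shows "\<phi> \<in> cochains K k"
proof -
  have "\<forall>xs\<in>ordered_cliques K k. \<phi> (permute_list \<pi> xs) = of_int (sign \<pi>) * \<phi> xs"
    if "\<pi> permutes {..<k + 1}" for \<pi>
    using that
  proof (induction rule: permutes_lessThan_adjacent_induct)
    case id
    then show ?case by simp
  next
    case (adjacent i)
    show ?case
    proof
      fix xs assume xs: "xs \<in> ordered_cliques K k"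
      then have i: "Suc i < length xs" using adjacent by (simp add: ordered_cliques_def)
      have eq: "xs = take i xs @ xs ! i # xs ! Suc i # drop (Suc (Suc i)) xs"
        using i by (metis Cons_nth_drop_Suc Suc_lessD append_take_drop_id)
      have len: "length (take i xs) = i" using i by simp
      have "permute_list (transpose i (Suc i)) xs
          = take i xs @ xs ! Suc i # xs ! i # drop (Suc (Suc i)) xs"
        using permute_list_adjacent[of "take i xs" "xs ! i" "xs ! Suc i" "drop (Suc (Suc i)) xs"]
        unfolding len eq[symmetric] .
      then show "\<phi> (permute_list (transpose i (Suc i)) xs)
          = of_int (sign (transpose i (Suc i))) * \<phi> xs"
        using swap[of "take i xs" "xs ! i" "xs ! Suc i" "drop (Suc (Suc i)) xs"] xs
        unfolding eq[symmetric] by (simp add: sign_swap_id)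
    qed
  next
    case (comp p q)
    show ?case
    proof
      fix xs assume xs: "xs \<in> ordered_cliques K k"
      have "\<phi> (permute_list (p \<circ> q) xs) = \<phi> (permute_list q (permute_list p xs))"
        using comp(2) xs by (subst permute_list_compose) (simp_all add: ordered_cliques_def)
      also have "\<dots> = of_int (sign q) * (of_int (sign p) * \<phi> xs)"
        using comp(3,4) xs permute_list_ordered_clique[OF xs comp(1)] by simp
      also have "\<dots> = of_int (sign p * sign q) * \<phi> xs"
        by simp
      also have "sign p * sign q = sign (p \<circ> q)"
        using comp(1,2) by (metis finite_lessThan permutation_permutes sign_compose)
      finally show "\<phi> (permute_list (p \<circ> q) xs) = of_int (sign (p \<circ> q)) * \<phi> xs" .
    qed
  qed
  then show ?thesis unfolding cochains_def using supp by blast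
qed

lemma cochains_swap_adjacent:
  assumes "\<phi> \<in> cochains K k"
  shows "\<phi> (us @ b # a # vs) = - \<phi> (us @ a # b # vs)"
proof (cases "us @ a # b # vs \<in> ordered_cliques K k")
  case True
  let ?t = "transpose (length us) (Suc (length us))"
  have "?t permutes {..<k + 1}"
    using True by (intro permutes_swap_id) (auto simp: ordered_cliques_def)
  with True assms have "\<phi> (permute_list ?t (us @ a # b # vs))
      = of_int (sign ?t) * \<phi> (us @ a # b # vs)"
    unfolding cochains_def by blast
  then show ?thesis by (simp add: permute_list_adjacent sign_swap_id)
next
  case False
  moreover from this have "us @ b # a # vs \<notin> ordered_cliques K k"
    by (auto simp: ordered_cliques_def insert_commute)
  ultimately show ?thesis using assms by (simp add: cochains_def)
qed

section \<open>The coboundary operator\<close>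

definition face :: "nat \<Rightarrow> 'a list \<Rightarrow> 'a list" where
  "face j xs = take j xs @ drop (Suc j) xs"

lemma coboundary_face:
  "coboundary K k \<phi> xs =
     (if xs \<in> ordered_cliques K (k + 1) then \<Sum>j\<le>k + 1. (- 1) ^ j * \<phi> (face j xs) else 0)"
  by (simp add: coboundary_def face_def)

lemma face_append_left: "j < length us \<Longrightarrow> face j (us @ vs) = face j us @ vs"
  by (simp add: face_def)

lemma face_append_right: "length us \<le> j \<Longrightarrow> face j (us @ vs) = us @ face (j - length us) vs"
  by (simp add: face_def Suc_diff_le)

lemma face_Cons_0: "face 0 (a # xs) = xs"
  by (simp add: face_def)

lemma face_Cons_Suc: "face (Suc j) (a # xs) = a # face j xs"
  by (simp add: face_def)

lemma face_face:
  assumes "i \<le> j"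
  shows "face j (face i xs) = face i (face (Suc j) xs)"
  using assms
proof (induction xs arbitrary: i j)
  case Nil
  then show ?case by (simp add: face_def)
next
  case (Cons x xs)
  show ?case
  proof (cases i)
    case 0
    then show ?thesis by (simp add: face_Cons_0 face_Cons_Suc)
  next
    case (Suc i')
    then obtain j' where j': "j = Suc j'" "i' \<le> j'"
      using Cons.prems by (cases j) auto
    show ?thesis
      unfolding Suc j'(1) face_Cons_Suc using Cons.IH[OF j'(2)] by simp
  qed
qed

lemma face_ordered_clique:
  assumes K: "clique_complex d V K" and xs: "xs \<in> ordered_cliques K (Suc k)" and j: "j \<le> k + 1"
  shows "face j xs \<in> ordered_cliques K k"
proof -
  have len: "length xs = k + 2" and dist: "distinct xs" and "set xs \<in> K"
    using xs by (auto simp: ordered_cliques_def)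
  have flen: "length (face j xs) = k + 1" using len j by (simp add: face_def)
  have "set (face j xs) \<subseteq> set xs"
    by (auto simp: face_def dest: in_set_takeD in_set_dropD)
  moreover have "set (face j xs) \<noteq> {}" using flen by auto
  ultimately have "set (face j xs) \<in> K"
    using K \<open>set xs \<in> K\<close> unfolding clique_complex_def by blast
  moreover have "distinct (face j xs)"
    using dist set_take_disj_set_drop_if_distinct[of xs j "Suc j"] by (simp add: face_def)
  ultimately show ?thesis using flen by (simp add: ordered_cliques_def)
qed

text \<open>Exchanging the neighbours at positions \<open>i\<close> and \<open>i + 1\<close> exchanges the two
  faces that omit one of them, which stand with opposite signs in the sum; every other face
  keeps both, still adjacent, and changes sign because \<open>\<phi>\<close> alternates.\<close>

lemma coboundary_in_cochains:
  assumes \<phi>: "\<phi> \<in> cochains K k"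
  shows "coboundary K k \<phi> \<in> cochains K (k + 1)"
proof (rule cochainsI_adjacent)
  fix us vs and a b :: 'a
  let ?xs = "us @ a # b # vs" and ?ys = "us @ b # a # vs"
  let ?i = "length us"
  let ?t = "transpose ?i (Suc ?i)"
  assume xs: "?xs \<in> ordered_cliques K (k + 1)"
  then have ys: "?ys \<in> ordered_cliques K (k + 1)"
    by (auto simp: ordered_cliques_def insert_commute)
  have summand: "(- 1) ^ j * \<phi> (face j ?ys) = - ((- 1) ^ ?t j * \<phi> (face (?t j) ?xs))" for j
  proof -
    consider "j < ?i" | "j = ?i" | "j = Suc ?i" | m where "j = ?i + Suc (Suc m)"
      by (metis add_Suc_right less_iff_Suc_add linorder_neqE_nat not_less_eq)
    then show ?thesis
    proof cases
      case 1
      then show ?thesis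
        using cochains_swap_adjacent[OF \<phi>, of "face j us" b a vs]
        by (simp add: face_append_left)
    next
      case 4
      then show ?thesis
        using cochains_swap_adjacent[OF \<phi>, of us b a "face m vs"]
        by (simp add: face_append_right face_Cons_Suc)
    qed (simp_all add: face_append_right face_Cons_0 face_Cons_Suc)
  qed
  have "?t permutes {..k + 1}"
    using xs by (intro permutes_swap_id) (auto simp: ordered_cliques_def)
  then have "(\<Sum>j\<le>k + 1. (- 1) ^ j * \<phi> (face j ?xs))
      = (\<Sum>j\<le>k + 1. (- 1) ^ ?t j * \<phi> (face (?t j) ?xs))"
    by (subst sum.permute[where p = ?t]) (simp_all add: o_def)
  then show "coboundary K k \<phi> ?ys = - coboundary K k \<phi> ?xs"
    using xs ys unfolding coboundary_face by (simp only: summand sum_negf if_True)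
qed (simp add: coboundary_def)

lemma coboundary_zero: "coboundary K k (\<lambda>_. 0) = (\<lambda>_. 0)"
  by (simp add: coboundary_def fun_eq_iff)

text \<open>The face that omits positions \<open>p < q\<close> arises twice in the double sum: by deleting
  \<open>p\<close> and then index \<open>q - 1\<close> of the shorter list, or \<open>q\<close> and then \<open>p\<close>.
  The two occurrences have opposite signs.\<close>

lemma coboundary_coboundary:
  assumes K: "clique_complex d V K"
  shows "coboundary K (k + 1) (coboundary K k \<phi>) = (\<lambda>_. 0)"
proof
  fix xs
  show "coboundary K (k + 1) (coboundary K k \<phi>) xs = 0"
  proof (cases "xs \<in> ordered_cliques K (k + 2)")
    case True
    define t where "t = (\<lambda>(i, j). (- 1) ^ (i + j) * \<phi> (face j (face i xs)))"
    let ?A = "{(i, j). i \<le> j \<and> j \<le> k + 1}" and ?B = "{(i, j). j < i \<and> i \<le> k + 2}"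
    have finA: "finite ?A"
      by (rule finite_subset[of _ "{..k + 1} \<times> {..k + 1}"]) auto
    have finB: "finite ?B"
      by (rule finite_subset[of _ "{..k + 2} \<times> {..k + 2}"]) auto
    have "coboundary K (k + 1) (coboundary K k \<phi>) xs
        = (\<Sum>i\<le>k + 2. (- 1) ^ i * coboundary K k \<phi> (face i xs))"
      using True by (simp add: coboundary_face)
    also have "\<dots> = (\<Sum>i\<le>k + 2. \<Sum>j\<le>k + 1. t (i, j))"
    proof (rule sum.cong[OF refl])
      fix i assume "i \<in> {..k + 2}"
      then have "face i xs \<in> ordered_cliques K (k + 1)"
        using face_ordered_clique[OF K, of xs "k + 1" i] True by simp
      then show "(- 1) ^ i * coboundary K k \<phi> (face i xs) = (\<Sum>j\<le>k + 1. t (i, j))"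
        by (simp only: coboundary_face if_True sum_distrib_left t_def prod.case power_add
            mult.assoc)
    qed
    also have "\<dots> = sum t ({..k + 2} \<times> {..k + 1})"
      by (simp only: sum.cartesian_product case_prod_eta)
    also have "{..k + 2} \<times> {..k + 1} = ?A \<union> ?B" by auto
    also have "sum t (?A \<union> ?B) = sum t ?A + sum t ?B"
      using finA finB by (intro sum.union_disjoint) auto
    also have "sum t ?A = (\<Sum>p\<in>?B. - t p)"
    proof (rule sum.reindex_bij_witness[where i = "\<lambda>(i, j). (j, i - 1)"
          and j = "\<lambda>(i, j). (Suc j, i)"])
      fix p assume "p \<in> ?A"
      then show "- t (case p of (i, j) \<Rightarrow> (Suc j, i)) = t p"
        by (auto simp: t_def face_face add.commute)
    qed auto
    finally show ?thesis by (simp add: sum_negf)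
  qed (simp add: coboundary_def)
qed

section \<open>Positive diagonal matrices acting on cochains\<close>

lemma zero_in_cochains: "(\<lambda>_. 0) \<in> cochains K k"
  by (simp add: cochains_def)

lemma diagonal_mult_vec_index:
  fixes M :: "'a::semiring_0 mat"
  assumes M: "M \<in> carrier_mat n n" "diagonal_mat M" and v: "v \<in> carrier_vec n" and i: "i < n"
  shows "(M *\<^sub>v v) $ i = M $$ (i, i) * v $ i"
proof -
  have "(M *\<^sub>v v) $ i = (\<Sum>j\<in>{0..<n}. M $$ (i, j) * v $ j)"
    using carrier_matD[OF M(1)] carrier_vecD[OF v] i by (simp add: scalar_prod_def)
  also have "\<dots> = (\<Sum>j\<in>{0..<n}. if j = i then M $$ (i, i) * v $ i else 0)"
    using M(2) carrier_matD[OF M(1)] i by (intro sum.cong refl) (simp add: diagonal_mat_def)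
  finally show ?thesis using i by simp
qed

lemma bij_betw_diagonal_mult_vec:
  fixes M :: "'a::field mat"
  assumes M: "M \<in> carrier_mat n n" "diagonal_mat M" and nz: "\<And>i. i < n \<Longrightarrow> M $$ (i, i) \<noteq> 0"
  shows "bij_betw ((*\<^sub>v) M) (carrier_vec n) (carrier_vec n)"
proof (rule bij_betw_byWitness[where f' = "\<lambda>v. vec n (\<lambda>i. v $ i / M $$ (i, i))"])
  show "\<forall>v\<in>carrier_vec n. vec n (\<lambda>i. (M *\<^sub>v v) $ i / M $$ (i, i)) = v"
    using nz by (auto intro!: eq_vecI simp: diagonal_mult_vec_index[OF M] simp del: index_mult_mat_vec)
  show "\<forall>v\<in>carrier_vec n. M *\<^sub>v vec n (\<lambda>i. v $ i / M $$ (i, i)) = v"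
    using nz M(1)
    by (auto intro!: eq_vecI simp: diagonal_mult_vec_index[OF M] simp del: index_mult_mat_vec)
qed (use M in auto)

lemma bij_betw_mat_action:
  assumes os: "orientation K k os"
    and M: "bij_betw ((*\<^sub>v) M) (carrier_vec (card (cliques K k))) (carrier_vec (card (cliques K k)))"
  shows "bij_betw (mat_action K k os M) (cochains K k) (cochains K k)"
proof -
  note c = bij_betw_coords[OF os]
  have "mat_action K k os M
      = the_inv_into (cochains K k) (coords os) \<circ> ((*\<^sub>v) M \<circ> coords os)"
    by (simp add: fun_eq_iff mat_action_def)
  then show ?thesis
    using bij_betw_trans[OF bij_betw_trans[OF c M] bij_betw_the_inv_into[OF c]] by simp
qed

lemma mat_action_zero:
  assumes os: "orientation K k os"
    and M: "M \<in> carrier_mat (card (cliques K k)) (card (cliques K k))"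
  shows "mat_action K k os M (\<lambda>_. 0) = (\<lambda>_. 0)"
proof -
  have z: "coords os (\<lambda>_. 0) = 0\<^sub>v (card (cliques K k))"
    using length_orientation[OF os] by (auto simp: coords_def)
  have "M *\<^sub>v coords os (\<lambda>_. 0) = coords os (\<lambda>_. 0)"
    using M unfolding z by (intro eq_vecI) auto
  then show ?thesis
    using bij_betw_coords[OF os] zero_in_cochains[of K k]
    by (simp add: mat_action_def bij_betw_def the_inv_into_f_f)
qed

section \<open>Conjugating a sequence of maps by bijections\<close>

text \<open>A kernel is the set of points sent to \<open>0\<close>, and an image is a plain set image. A
  bijection that fixes \<open>0\<close> sends nothing else there, so it carries kernels to kernels
  and images to images: exactness is transported at the level of sets.\<close>

locale conjugate_sequence =
  fixes d :: nat
    and C :: "nat \<Rightarrow> ('v list \<Rightarrow> real) set"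
    and D :: "nat \<Rightarrow> ('v list \<Rightarrow> real) \<Rightarrow> 'v list \<Rightarrow> real"
    and A :: "nat \<Rightarrow> ('v list \<Rightarrow> real) \<Rightarrow> 'v list \<Rightarrow> real"
  assumes zero_mem: "(\<lambda>_. 0) \<in> C k"
    and D_mem: "\<phi> \<in> C k \<Longrightarrow> D k \<phi> \<in> C (k + 1)"
    and A_bij: "k \<le> d \<Longrightarrow> bij_betw (A k) (C k) (C k)"
    and A_zero: "k \<le> d \<Longrightarrow> A k (\<lambda>_. 0) = (\<lambda>_. 0)"
begin

definition conjugate :: "nat \<Rightarrow> ('v list \<Rightarrow> real) \<Rightarrow> 'v list \<Rightarrow> real" where
  "conjugate k \<phi> = A (k + 1) (D k (the_inv_into (C k) (A k) \<phi>))"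

lemma A_mem: "k \<le> d \<Longrightarrow> \<phi> \<in> C k \<Longrightarrow> A k \<phi> \<in> C k"
  using A_bij by (auto simp: bij_betw_def)

lemma C_eq_image: "k \<le> d \<Longrightarrow> C k = A k ` C k"
  using A_bij by (simp add: bij_betw_def)

lemma A_eq_zero_iff: "k \<le> d \<Longrightarrow> \<phi> \<in> C k \<Longrightarrow> A k \<phi> = (\<lambda>_. 0) \<longleftrightarrow> \<phi> = (\<lambda>_. 0)"
  using A_bij[of k] A_zero[of k] zero_mem[of k] by (auto simp: bij_betw_def inj_on_def)

lemma conjugate_A: "k \<le> d \<Longrightarrow> \<phi> \<in> C k \<Longrightarrow> conjugate k (A k \<phi>) = A (k + 1) (D k \<phi>)"
  using A_bij[of k] by (simp add: conjugate_def bij_betw_def the_inv_into_f_f)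

lemma kernel_conjugate:
  assumes "k + 1 \<le> d"
  shows "{\<phi> \<in> C k. conjugate k \<phi> = (\<lambda>_. 0)} = A k ` {\<phi> \<in> C k. D k \<phi> = (\<lambda>_. 0)}"
proof -
  have "conjugate k (A k \<phi>) = (\<lambda>_. 0) \<longleftrightarrow> D k \<phi> = (\<lambda>_. 0)" if "\<phi> \<in> C k" for \<phi>
    using conjugate_A[OF _ that] A_eq_zero_iff[OF assms D_mem[OF that]] assms by simp
  moreover have "\<exists>\<psi>\<in>C k. \<phi> = A k \<psi>" if "\<phi> \<in> C k" for \<phi>
    using that C_eq_image[of k] assms by (metis imageE add_leD1)
  ultimately show ?thesis using A_mem[of k] assms by fastforce
qed

lemma image_conjugate:
  assumes "k + 1 \<le> d"
  shows "conjugate k ` C k = A (k + 1) ` D k ` C k"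
proof -
  have "conjugate k ` C k = conjugate k ` A k ` C k"
    by (rule arg_cong[OF C_eq_image]) (use assms in simp)
  also have "\<dots> = A (k + 1) ` D k ` C k"
    unfolding image_image using assms by (intro image_cong) (simp_all add: conjugate_A)
  finally show ?thesis .
qed

lemma exact_sequence_conjugate:
  assumes "exact_sequence d C D"
  shows "exact_sequence d C conjugate"
  unfolding exact_sequence_def
proof (intro allI impI)
  fix k assume k: "1 \<le> k \<and> k \<le> d - 1"
  then have "k + 1 \<le> d" "k - 1 + 1 \<le> d" "k - 1 + 1 = k" by auto
  moreover have "{\<phi> \<in> C k. D k \<phi> = (\<lambda>_. 0)} = D (k - 1) ` C (k - 1)"
    using assms k by (simp add: exact_sequence_def)
  ultimately show "{\<phi> \<in> C k. conjugate k \<phi> = (\<lambda>_. 0)} = conjugate (k - 1) ` C (k - 1)"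
    using kernel_conjugate[of k] image_conjugate[of "k - 1"] by simp
qed

lemma conjugate_compose_zero:
  assumes k: "k + 2 \<le> d" and \<phi>: "\<phi> \<in> C k"
    and DD: "\<And>\<psi>. \<psi> \<in> C k \<Longrightarrow> D (k + 1) (D k \<psi>) = (\<lambda>_. 0)"
  shows "conjugate (k + 1) (conjugate k \<phi>) = (\<lambda>_. 0)"
proof -
  obtain \<psi> where \<psi>: "\<psi> \<in> C k" "\<phi> = A k \<psi>" using C_eq_image[of k] k \<phi> by (metis imageE add_leD1)
  have "conjugate (k + 1) (conjugate k \<phi>) = conjugate (k + 1) (A (k + 1) (D k \<psi>))"
    using k \<psi> by (simp add: conjugate_A)
  also have "\<dots> = A (k + 1 + 1) (D (k + 1) (D k \<psi>))"
    using k D_mem[OF \<psi>(1)] by (intro conjugate_A) auto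
  finally show ?thesis using DD[OF \<psi>(1)] A_zero[of "k + 2"] k by simp
qed

end

section \<open>The weighted sequence\<close>

theorem theorem3p1:
  fixes d :: nat
    and V :: "'v set"
    and K :: "'v set set"
    and os :: "nat \<Rightarrow> 'v list list"
    and B :: "nat \<Rightarrow> real mat"
  assumes "d \<ge> 1"
    and "clique_complex d V K"
    and "\<And>k. k \<le> d \<Longrightarrow> orientation K k (os k)"
    and "\<And>k. k \<le> d \<Longrightarrow> B k \<in> carrier_mat (card (cliques K k)) (card (cliques K k))"
    and "\<And>k. k \<le> d \<Longrightarrow> diagonal_mat (B k)"
    and "\<And>k i. k \<le> d \<Longrightarrow> i < card (cliques K k) \<Longrightarrow> B k $$ (i, i) > 0"
  shows "(exact_sequence d (cochains K) (coboundary K) \<longrightarrow>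
          exact_sequence d (cochains K) (weighted_coboundary K os B)) \<and>
         (\<forall>k. k + 2 \<le> d \<longrightarrow>
            (\<forall>\<phi> \<in> cochains K k.
               weighted_coboundary K os B (k + 1) (weighted_coboundary K os B k \<phi>) = (\<lambda>_. 0)))"
proof -
  interpret conjugate_sequence d "cochains K" "coboundary K" "\<lambda>k. mat_action K k (os k) (B k)"
  proof
    fix k assume k: "k \<le> d"
    have "B k $$ (i, i) \<noteq> 0" if "i < card (cliques K k)" for i
      using assms(6)[OF k that] by simp
    then show "bij_betw (mat_action K k (os k) (B k)) (cochains K k) (cochains K k)"
      using assms(3-5)[OF k] by (intro bij_betw_mat_action bij_betw_diagonal_mult_vec)
    show "mat_action K k (os k) (B k) (\<lambda>_. 0) = (\<lambda>_. 0)"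
      using assms(3,4)[OF k] by (rule mat_action_zero)
  qed (rule zero_in_cochains, rule coboundary_in_cochains)
  have "weighted_coboundary K os B = conjugate"
    by (simp add: fun_eq_iff weighted_coboundary_def conjugate_def)
  then show ?thesis
    using exact_sequence_conjugate conjugate_compose_zero coboundary_coboundary[OF assms(2)]
    by auto
qed

end
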